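(* Let $L>0$, $n\ge 1$, and let $f(\cdot;1),\dots,f(\cdot;n):\mathbb{R}^d\to\mathbb{R}$ be differentiable functions (not necessarily convex) such that $\|\nabla f(x;i)-\nabla f(y;i)\|\le L\|x-y\|$ for all $x,y\in\mathbb{R}^d$ and $i\in\{1,\dots,n\}$. Let $F(w)=\frac1n\sum_{i=1}^n f(w;i)$, assume that $F$ is convex and has a minimizer, and let $x_*$ be any minimizer of $F$. Assume there are finite constants $\Theta\ge 0$ and $\sigma\ge 0$ such that for all $x\in\mathbb{R}^d$ $$\frac1n\sum_{i=1}^n\|\nabla f(x;i)-\nabla F(x)\|^2\le \Theta\|\nabla F(x)\|^2+\sigma^2 .$$ Let $T\ge 2$ be an integer, $\alpha=1+\frac1T$, $k=\frac{1}{e\,\alpha\,\sqrt[3]{2(6\Theta+7)}}$. Run the NASG algorithm for $T$ epochs from an initial point $\tilde y_0=\tilde x_0\in\mathbb{R}^d$, with an arbitrary permutation $\pi^{(t)}$ of $\{1,\dots,n\}$ in each epoch $t$, with momentum parameters $\gamma_t=\frac{t-1}{t+2}$ and learning rates $\eta_i^{(t)}=\frac{\eta_t}{n}>0$, where $\eta_t=\frac{k\alpha^t}{LT}\le\frac1L$. Then $$F(\tilde x_T)-F(x_* )\le \frac{8\sigma^2}{3(6\Theta+7)LT}+\frac{2Le\sqrt[3]{2(6\Theta+7)}}{T}\,\|\tilde x_0-x_*\|^2 .$$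
   Context: NASG (Nesterov Accelerated Shuffling Gradient) algorithm: given initial points $\tilde x_0,\tilde y_0\in\mathbb{R}^d$, parameters $\gamma_t$ and learning rates $\eta_i^{(t)}>0$, for each epoch $t=1,2,\dots,T$: set $y_0^{(t)}:=\tilde y_{t-1}$; choose a permutation $\pi^{(t)}$ of $\{1,\dots,n\}$ (deterministic or random); for $i=1,\dots,n$ set $y_i^{(t)}:=y_{i-1}^{(t)}-\eta_i^{(t)}\nabla f(y_{i-1}^{(t)};\pi^{(t)}(i))$; then set $\tilde x_t:=y_n^{(t)}$ and $\tilde y_t:=\tilde x_t+\gamma_t(\tilde x_t-\tilde x_{t-1})$. Here $e$ is Euler's number. The result holds deterministically for every choice of permutations. *)

theory Defs
  imports "HOL-Analysis.Analysis" "HOL-Combinatorics.Permutations"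
begin

text \<open>The gradient, characterised by the library predicate \<^const>\<open>gderiv\<close>. The description
  operator yields an unspecified value where \<open>f\<close> is not differentiable.\<close>

definition grad :: "('a::real_inner \<Rightarrow> real) \<Rightarrow> 'a \<Rightarrow> 'a" where
  "grad f x = (THE D. GDERIV f x :> D)"

lemma grad_eqI:
  assumes "GDERIV f x :> D"
  shows "grad f x = D"
  unfolding grad_def
proof (rule the_equality)
  show "GDERIV f x :> D" by fact
next
  fix D' assume "GDERIV f x :> D'"
  with assms have "(\<lambda>h. h \<bullet> D') = (\<lambda>h. h \<bullet> D)"
    unfolding gderiv_def by (rule has_derivative_unique[rotated])
  then have "h \<bullet> D' = h \<bullet> D" for h by meson
  then have "(D' - D) \<bullet> (D' - D) = 0" by (simp add: inner_diff_right)
  then show "D' = D" by simp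
qed

lemma gderiv_grad:
  fixes f :: "'a::euclidean_space \<Rightarrow> real"
  assumes "f differentiable (at x)"
  shows "GDERIV f x :> grad f x"
proof -
  from assms obtain f' where f': "(f has_derivative f') (at x)"
    unfolding differentiable_def by blast
  then interpret linear f' by (rule has_derivative_linear)
  define D where "D = (\<Sum>b\<in>Basis. f' b *\<^sub>R b)"
  have "f' h = h \<bullet> D" for h
  proof -
    have "f' h = f' (\<Sum>b\<in>Basis. (h \<bullet> b) *\<^sub>R b)" by (simp add: euclidean_representation)
    also have "\<dots> = (\<Sum>b\<in>Basis. (h \<bullet> b) * f' b)" by (simp add: sum scale)
    also have "\<dots> = h \<bullet> D"
      unfolding D_def by (simp add: inner_sum_right mult.commute)
    finally show ?thesis .
  qed
  then have "f' = (\<lambda>h. h \<bullet> D)" by blast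
  with f' have D: "GDERIV f x :> D" unfolding gderiv_def by simp
  with grad_eqI[OF D] show ?thesis by simp
qed

definition avg_fun :: "nat \<Rightarrow> (nat \<Rightarrow> 'a \<Rightarrow> real) \<Rightarrow> 'a \<Rightarrow> real" where
  "avg_fun n f w = (1 / real n) * (\<Sum>i=1..n. f i w)"

text \<open>
  \<open>nasg_run n f T \<gamma> \<eta> \<pi> x y v\<close>: the sequences form a run over \<open>T\<close> epochs of the Nesterov
  accelerated shuffling gradient method on the components \<open>f 1, \<dots>, f n\<close>. Here \<open>x t\<close> and \<open>y t\<close>
  are the outer iterates (usually written with a tilde), with initial points \<open>x 0\<close> and \<open>y 0\<close>;
  \<open>v t i\<close> is the inner iterate of epoch \<open>t\<close> after \<open>i\<close> component steps, \<open>\<eta> t i\<close> the learning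
  rate of step \<open>i\<close> in epoch \<open>t\<close>, and \<open>\<pi> t\<close> the permutation used in epoch \<open>t\<close>. Entries with
  \<open>t > T\<close> or \<open>i > n\<close> are irrelevant.
\<close>

definition nasg_run ::
  "nat \<Rightarrow> (nat \<Rightarrow> 'a::real_inner \<Rightarrow> real) \<Rightarrow> nat \<Rightarrow> (nat \<Rightarrow> real) \<Rightarrow> (nat \<Rightarrow> nat \<Rightarrow> real) \<Rightarrow>
    (nat \<Rightarrow> nat \<Rightarrow> nat) \<Rightarrow> (nat \<Rightarrow> 'a) \<Rightarrow> (nat \<Rightarrow> 'a) \<Rightarrow> (nat \<Rightarrow> nat \<Rightarrow> 'a) \<Rightarrow> bool" where
  "nasg_run n f T \<gamma> \<eta> \<pi> x y v \<longleftrightarrow>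
    (\<forall>t\<in>{1..T}.
        v t 0 = y (t - 1) \<and>
        \<pi> t permutes {1..n} \<and>
        (\<forall>i\<in>{1..n}. v t i = v t (i - 1) - \<eta> t i *\<^sub>R grad (f (\<pi> t i)) (v t (i - 1))) \<and>
        x t = v t n \<and>
        y t = x t + \<gamma> t *\<^sub>R (x t - x (t - 1)))"

end

theory Submission
  imports Defs
begin

text \<open>
  One epoch is a gradient step with step size \<open>\<eta>\<^sub>t\<close> from \<open>y\<^bsub>t-1\<^esub>\<close>, perturbed by an error \<open>e\<^sub>t\<close> with
  \<open>|e\<^sub>t|\<^sup>2 \<le> 8 (\<eta>\<^sub>t L)\<^sup>2 ((1 + \<Theta>) |\<nabla>F(y\<^bsub>t-1\<^esub>)|\<^sup>2 + \<sigma>\<^sup>2)\<close>, because \<open>\<eta>\<^sub>t L \<le> 1/2\<close> bounds the drift of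
  the inner iterates. Nesterov's estimate with \<open>\<theta>\<^sub>t = 2 / (t + 1)\<close> and
  \<open>z\<^sub>t = x\<^bsub>t-1\<^esub> + (x\<^sub>t - x\<^bsub>t-1\<^esub>) / \<theta>\<^sub>t\<close> then leaves the extra term \<open>- \<eta>\<^sub>t / \<theta>\<^sub>t (e\<^sub>t \<bullet> (z\<^sub>t - x\<^sub>*))\<close>. Young's
  inequality with weight \<open>T + 1\<close> splits it: the part in \<open>|z\<^sub>t - x\<^sub>*|\<^sup>2\<close> turns the coefficient \<open>1\<close>
  into \<open>1 - 1 / (T + 1) = 1 / \<alpha>\<close>, which the growth \<open>\<eta>\<^bsub>t+1\<^esub> = \<alpha> \<eta>\<^sub>t\<close> compensates, and the gradient part
  of \<open>|e\<^sub>t|\<^sup>2\<close> is absorbed by the term \<open>|\<nabla>F(y\<^bsub>t-1\<^esub>)|\<^sup>2 / (2 L)\<close> by which the minimum exceeds the tangent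
  at \<open>y\<^bsub>t-1\<^esub>\<close>. Hence, with \<open>a = k \<alpha> / (L T)\<close>, the potential
  \<open>a t (t + 2) / 4 (F(x\<^sub>t) - F(x\<^sub>*)) + |z\<^sub>t - x\<^sub>*|\<^sup>2 / (2 \<alpha>\<^sup>t)\<close> grows by at most a constant multiple of
  \<open>\<sigma>\<^sup>2\<close> per epoch.
\<close>

section \<open>Gradient inequalities and one inexact accelerated step\<close>

lemma has_real_derivative_along_line:
  assumes "GDERIV F (z + s *\<^sub>R d) :> D"
  shows "((\<lambda>s. F (z + s *\<^sub>R d)) has_real_derivative D \<bullet> d) (at s)"
proof -
  have "((\<lambda>s. z + s *\<^sub>R d) has_derivative (\<lambda>h. h *\<^sub>R d)) (at s)"
    by (auto intro!: derivative_eq_intros)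
  moreover have "(F has_derivative (\<lambda>h. h \<bullet> D)) (at (z + s *\<^sub>R d))"
    using assms by (simp add: gderiv_def)
  ultimately have "((\<lambda>s. F (z + s *\<^sub>R d)) has_derivative (\<lambda>h. (h *\<^sub>R d) \<bullet> D)) (at s)"
    by (rule has_derivative_compose)
  then show ?thesis
    by (simp add: has_field_derivative_def inner_commute mult_commute_abs)
qed

text \<open>Restriction to the line through \<open>z\<close> and \<open>w\<close> reduces this to
  the tangent inequality for a convex function of one real variable, taken between 0 and 1.\<close>

lemma convex_on_above_gderiv_tangent:
  assumes "convex_on UNIV F" and "GDERIV F z :> D"
  shows "F w \<ge> F z + D \<bullet> (w - z)"
proof -
  define d where "d = w - z"
  have "convex_on UNIV (\<lambda>s. F (z + s *\<^sub>R d))"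
  proof (rule convex_onI)
    fix u a b :: real
    assume u: "0 < u" "u < 1"
    have "z + ((1 - u) *\<^sub>R a + u *\<^sub>R b) *\<^sub>R d
        = (1 - u) *\<^sub>R (z + a *\<^sub>R d) + u *\<^sub>R (z + b *\<^sub>R d)"
      by (simp add: algebra_simps)
    then show "F (z + ((1 - u) *\<^sub>R a + u *\<^sub>R b) *\<^sub>R d)
        \<le> (1 - u) * F (z + a *\<^sub>R d) + u * F (z + b *\<^sub>R d)"
      using convex_onD[OF assms(1), of u] u by simp
  qed simp
  moreover have "((\<lambda>s. F (z + s *\<^sub>R d)) has_real_derivative D \<bullet> d) (at 0)"
    using assms(2) by (intro has_real_derivative_along_line) simp
  ultimately have "F (z + 1 *\<^sub>R d) - F (z + 0 *\<^sub>R d) \<ge> (D \<bullet> d) * (1 - 0)"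
    by (intro convex_on_imp_above_tangent[where A = UNIV]) auto
  then show ?thesis by (simp add: d_def)
qed

text \<open>Along the segment from \<open>z\<close> to \<open>w\<close>, \<open>\<phi>\<close> is
  \<open>F\<close> minus the linear and quadratic parts of the bound. By Cauchy-Schwarz and the
  Lipschitz condition its derivative is nonpositive, so \<open>\<phi>\<close> does not increase from
  0 to 1.\<close>

lemma lipschitz_gderiv_upper_bound:
  fixes G :: "'a::real_inner \<Rightarrow> 'a"
  assumes "\<And>w. GDERIV F w :> G w" and "\<And>w z. norm (G w - G z) \<le> L * norm (w - z)"
  shows "F w \<le> F z + G z \<bullet> (w - z) + L / 2 * (norm (w - z))\<^sup>2"
proof -
  define d where "d = w - z"
  define \<phi> where "\<phi> s = F (z + s *\<^sub>R d) - s * (G z \<bullet> d) - L / 2 * s\<^sup>2 * (norm d)\<^sup>2" for s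
  have "\<phi> 1 \<le> \<phi> 0"
  proof (rule DERIV_nonpos_imp_nonincreasing[where f = \<phi>])
    fix s :: real
    assume s: "0 \<le> s" "s \<le> 1"
    have "(G (z + s *\<^sub>R d) - G z) \<bullet> d \<le> norm (G (z + s *\<^sub>R d) - G z) * norm d"
      by (rule norm_cauchy_schwarz)
    also have "\<dots> \<le> L * norm (s *\<^sub>R d) * norm d"
      using assms(2)[of "z + s *\<^sub>R d" z] by (intro mult_right_mono) auto
    also have "\<dots> = L * s * (norm d)\<^sup>2"
      using s by (simp add: power2_eq_square)
    finally have "G (z + s *\<^sub>R d) \<bullet> d - G z \<bullet> d - L * s * (norm d)\<^sup>2 \<le> 0"
      by (simp add: inner_diff_left)
    moreover have "(\<phi> has_real_derivative
        G (z + s *\<^sub>R d) \<bullet> d - G z \<bullet> d - L * s * (norm d)\<^sup>2) (at s)"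
      unfolding \<phi>_def
      by (auto intro!: derivative_eq_intros has_real_derivative_along_line assms(1))
    ultimately show "\<exists>y. (\<phi> has_real_derivative y) (at s) \<and> y \<le> 0" by blast
  qed simp
  then show ?thesis by (simp add: \<phi>_def d_def)
qed

lemma gderiv_zero_at_minimum:
  fixes F :: "'a::real_inner \<Rightarrow> real"
  assumes "\<And>w. F xstar \<le> F w" and "GDERIV F xstar :> D"
  shows "D = 0"
proof -
  have "((\<lambda>s. F (xstar + s *\<^sub>R D)) has_real_derivative D \<bullet> D) (at 0)"
    using assms(2) by (intro has_real_derivative_along_line) simp
  then have "D \<bullet> D = 0"
    by (rule DERIV_local_min[of _ _ _ 1]) (auto simp: assms(1))
  then show ?thesis by simp
qed

text \<open>A point \<open>w\<close> near \<open>xstar\<close> is compared twice: the quadratic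
  upper bound at \<open>xstar\<close>, where the gradient vanishes, and the tangent at
  \<open>z\<close> below. The squared gradient gained over the plain tangent inequality later pays
  for the error of an epoch.\<close>

lemma convex_on_above_tangent_at_minimum:
  fixes G :: "'a::real_inner \<Rightarrow> 'a"
  assumes "\<And>w. GDERIV F w :> G w" and "\<And>w z. norm (G w - G z) \<le> L * norm (w - z)"
    and "convex_on UNIV F" and "\<And>w. F xstar \<le> F w" and "L > 0"
  shows "F xstar \<ge> F z + G z \<bullet> (xstar - z) + (norm (G z))\<^sup>2 / (2 * L)"
proof -
  \<comment> \<open>This point maximises
    \<open>G z \<bullet> (w - z) - L / 2 * (norm (w - xstar))\<^sup>2\<close>, the gap between the
    two bounds.\<close>
  define w where "w = xstar + (1 / L) *\<^sub>R G z"
  have "G xstar = 0"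
    using gderiv_zero_at_minimum assms(1,4) by blast
  then have "F w \<le> F xstar + L / 2 * (norm (G z) / L)\<^sup>2"
    using lipschitz_gderiv_upper_bound[OF assms(1,2), of w xstar] \<open>L > 0\<close> by (simp add: w_def)
  also have "L / 2 * (norm (G z) / L)\<^sup>2 = (norm (G z))\<^sup>2 / (2 * L)"
    using \<open>L > 0\<close> by (simp add: power2_eq_square field_simps)
  finally have "F w \<le> F xstar + (norm (G z))\<^sup>2 / (2 * L)" .
  moreover have "F w \<ge> F z + G z \<bullet> (w - z)"
    by (rule convex_on_above_gderiv_tangent) fact+
  moreover have "G z \<bullet> (w - z) = G z \<bullet> (xstar - z) + (norm (G z))\<^sup>2 / L"
    by (simp add: w_def inner_simps power2_norm_eq_inner)
  moreover have "(norm (G z))\<^sup>2 / L = (norm (G z))\<^sup>2 / (2 * L) + (norm (G z))\<^sup>2 / (2 * L)"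
    using \<open>L > 0\<close> by (simp add: field_simps)
  ultimately show ?thesis by linarith
qed

text \<open>Add \<open>upper\<close>, \<open>1 - \<theta>\<close> times \<open>lower\<close> and
  \<open>\<theta>\<close> times \<open>lower_min\<close>; the terms linear in \<open>g\<close>
  collapse to one inner product with \<open>z' - xstar\<close>. The step equation replaces
  \<open>\<eta> *\<^sub>R g\<close> there by \<open>z' - z\<close> and \<open>e\<close>, which gives
  a telescoping difference of squared distances. The negative term in
  \<open>(norm g)\<^sup>2\<close> is kept to absorb \<open>e\<close> later.\<close>

lemma accelerated_step_inexact_gradient:
  fixes g e x x' y z z' xstar :: "'a::real_inner"
  assumes \<theta>: "0 < \<theta>" "\<theta> \<le> 1" and "0 < \<eta>" and "0 < L" and "\<eta> * L \<le> 1"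
    and x': "x' = y - \<eta> *\<^sub>R (g + e)" and y: "y = (1 - \<theta>) *\<^sub>R x + \<theta> *\<^sub>R z"
    and z': "z' = x + (1 / \<theta>) *\<^sub>R (x' - x)"
    and upper: "F x' \<le> F y + g \<bullet> (x' - y) + L / 2 * (norm (x' - y))\<^sup>2"
    and lower: "F x \<ge> F y + g \<bullet> (x - y)"
    and lower_min: "F xstar \<ge> F y + g \<bullet> (xstar - y) + (norm g)\<^sup>2 / (2 * L)"
  shows "\<eta> / \<theta>\<^sup>2 * (F x' - F xstar) + (norm (z' - xstar))\<^sup>2 / 2
    \<le> \<eta> * (1 - \<theta>) / \<theta>\<^sup>2 * (F x - F xstar) + (norm (z - xstar))\<^sup>2 / 2
      - \<eta> / (2 * L * \<theta>) * (norm g)\<^sup>2 - \<eta> / \<theta> * (e \<bullet> (z' - xstar))"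
proof -
  \<comment> \<open>So \<open>x'\<close> is the same combination of \<open>x\<close> and
    \<open>z'\<close> as \<open>y\<close> is of \<open>x\<close> and \<open>z\<close>; hence the
    steps \<open>x' - y\<close> and \<open>z' - z\<close> are proportional.\<close>
  have \<theta>z': "\<theta> *\<^sub>R z' = x' - (1 - \<theta>) *\<^sub>R x"
    using \<theta> by (simp add: z' algebra_simps)
  have step: "\<theta> *\<^sub>R (z' - z) = x' - y"
    by (simp add: y scaleR_diff_right \<theta>z')
  then have ge: "\<eta> *\<^sub>R g = - \<theta> *\<^sub>R (z' - z) - \<eta> *\<^sub>R e"
    by (simp add: x' algebra_simps)
  define N where "N = (norm (z' - z))\<^sup>2"
  have N: "(norm (x' - y))\<^sup>2 = \<theta>\<^sup>2 * N"
    by (simp add: step[symmetric] N_def power_mult_distrib)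
  have comb: "x' - y - (1 - \<theta>) *\<^sub>R (x - y) - \<theta> *\<^sub>R (xstar - y) = \<theta> *\<^sub>R (z' - xstar)"
    by (simp add: algebra_simps \<theta>z')
  have "F x' - F xstar \<le> (1 - \<theta>) * (F x - F xstar) - \<theta> * ((norm g)\<^sup>2 / (2 * L))
      + (g \<bullet> (x' - y) - (1 - \<theta>) * (g \<bullet> (x - y)) - \<theta> * (g \<bullet> (xstar - y))) + L / 2 * (\<theta>\<^sup>2 * N)"
    using upper mult_left_mono[OF lower, of "1 - \<theta>"] mult_left_mono[OF lower_min, of \<theta>] \<theta> N
    by (simp add: algebra_simps)
  also have "g \<bullet> (x' - y) - (1 - \<theta>) * (g \<bullet> (x - y)) - \<theta> * (g \<bullet> (xstar - y))
      = \<theta> * (g \<bullet> (z' - xstar))"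
    by (simp only: comb[symmetric] inner_scaleR_right[symmetric] inner_diff_right[symmetric])
  finally have "\<eta> * (F x' - F xstar) \<le> \<eta> * ((1 - \<theta>) * (F x - F xstar)
      - \<theta> * ((norm g)\<^sup>2 / (2 * L)) + \<theta> * (g \<bullet> (z' - xstar)) + L / 2 * (\<theta>\<^sup>2 * N))"
    using \<open>0 < \<eta>\<close> by simp
  also have "\<dots> = \<eta> * (1 - \<theta>) * (F x - F xstar) - \<eta> * \<theta> / (2 * L) * (norm g)\<^sup>2
      + \<theta> * ((\<eta> *\<^sub>R g) \<bullet> (z' - xstar)) + (\<eta> * L) * (\<theta>\<^sup>2 * N / 2)"
    by (simp add: algebra_simps)
  \<comment> \<open>This smoothness term is cancelled by the \<open>- N\<close> that the expansion
    of \<open>(z' - z) \<bullet> (z' - xstar)\<close> contributes below.\<close>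
  also have "(\<eta> * L) * (\<theta>\<^sup>2 * N / 2) \<le> 1 * (\<theta>\<^sup>2 * N / 2)"
    using \<open>\<eta> * L \<le> 1\<close> by (intro mult_right_mono) (auto simp: N_def)
  also have "(\<eta> *\<^sub>R g) \<bullet> (z' - xstar)
      = - \<theta> * ((z' - z) \<bullet> (z' - xstar)) - \<eta> * (e \<bullet> (z' - xstar))"
    unfolding ge by (simp only: inner_diff_left inner_scaleR_left)
  also have "(z' - z) \<bullet> (z' - xstar)
      = (N + (norm (z' - xstar))\<^sup>2 - (norm (z - xstar))\<^sup>2) / 2"
    by (simp add: N_def power2_norm_eq_inner inner_simps inner_commute)
  finally have "\<eta> * (F x' - F xstar) + \<theta>\<^sup>2 * (norm (z' - xstar))\<^sup>2 / 2
      \<le> \<eta> * (1 - \<theta>) * (F x - F xstar) + \<theta>\<^sup>2 * (norm (z - xstar))\<^sup>2 / 2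
        - \<eta> * \<theta> / (2 * L) * (norm g)\<^sup>2 - \<eta> * \<theta> * (e \<bullet> (z' - xstar))"
    by (simp add: algebra_simps power2_eq_square add_divide_distrib diff_divide_distrib)
  from divide_right_mono[OF this, of "\<theta>\<^sup>2"] show ?thesis
    using \<theta> by (simp add: add_divide_distrib diff_divide_distrib power2_eq_square)
qed

text \<open>Young's inequality, from the square of \<open>u + (r * s) *\<^sub>R e\<close>. The
  weight \<open>r\<close> is left free so that the coefficient of the squared distance can be
  tuned.\<close>

lemma neg_inner_le_weighted_norms:
  fixes e u :: "'a::real_inner"
  assumes "r > 0"
  shows "- (s * (e \<bullet> u)) \<le> (norm u)\<^sup>2 / (2 * r) + r / 2 * s\<^sup>2 * (norm e)\<^sup>2"
proof -
  have "0 \<le> (norm (u + (r * s) *\<^sub>R e))\<^sup>2"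
    by simp
  also have "\<dots> = (norm u)\<^sup>2 + 2 * r * s * (e \<bullet> u) + r\<^sup>2 * s\<^sup>2 * (norm e)\<^sup>2"
    unfolding power2_norm_eq_inner
    by (simp add: inner_add_left inner_add_right inner_commute[of u e]
        power2_eq_square algebra_simps)
  finally have "- (2 * r * s * (e \<bullet> u)) \<le> (norm u)\<^sup>2 + r\<^sup>2 * s\<^sup>2 * (norm e)\<^sup>2"
    by simp
  then have "- (2 * r * s * (e \<bullet> u)) / (2 * r)
      \<le> ((norm u)\<^sup>2 + r\<^sup>2 * s\<^sup>2 * (norm e)\<^sup>2) / (2 * r)"
    using assms by (intro divide_right_mono) auto
  then show ?thesis
    using assms by (simp add: add_divide_distrib power2_eq_square)
qed

section \<open>Component averages and one shuffled epoch\<close>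

lemma square_mean_le_mean_square:
  fixes u :: "nat \<Rightarrow> real"
  assumes "n \<ge> 1"
  shows "((\<Sum>i=1..n. u i) / real n)\<^sup>2 \<le> (\<Sum>i=1..n. (u i)\<^sup>2) / real n"
proof -
  have "(\<Sum>i=1..n. u i)\<^sup>2 \<le> (\<Sum>i=1..n. (u i)\<^sup>2) * (\<Sum>i=1..n. 1\<^sup>2)"
    using Cauchy_Schwarz_ineq_sum[of u "\<lambda>_. 1" "{1..n}"] by simp
  then show ?thesis
    using assms by (simp add: power_divide field_simps power2_eq_square)
qed

lemma gderiv_avg_fun:
  fixes f :: "nat \<Rightarrow> 'a::euclidean_space \<Rightarrow> real"
  assumes "\<And>i. i \<in> {1..n} \<Longrightarrow> f i differentiable (at w)"
  shows "GDERIV (avg_fun n f) w :> (1 / real n) *\<^sub>R (\<Sum>i=1..n. grad (f i) w)"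
proof -
  have "((\<lambda>w. (1 / real n) * (\<Sum>i=1..n. f i w)) has_derivative
      (\<lambda>h. (1 / real n) * (\<Sum>i=1..n. h \<bullet> grad (f i) w))) (at w)"
    using gderiv_grad[OF assms]
    by (intro has_derivative_mult_right has_derivative_sum) (simp add: gderiv_def)
  then show ?thesis
    unfolding gderiv_def avg_fun_def by (simp add: inner_sum_right)
qed

lemma lipschitz_average:
  fixes h :: "nat \<Rightarrow> 'a::real_normed_vector \<Rightarrow> 'a"
  assumes "n \<ge> 1"
    and "\<And>i. i \<in> {1..n} \<Longrightarrow> norm (h i w - h i z) \<le> L * norm (w - z)"
  shows "norm ((1 / real n) *\<^sub>R (\<Sum>i=1..n. h i w) - (1 / real n) *\<^sub>R (\<Sum>i=1..n. h i z))
    \<le> L * norm (w - z)"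
proof -
  have "norm (\<Sum>i=1..n. h i w - h i z) \<le> (\<Sum>i=1..n. L * norm (w - z))"
    using assms(2) by (intro sum_norm_le) auto
  then have "norm (\<Sum>i=1..n. h i w - h i z) / real n \<le> L * norm (w - z)"
    using assms(1) by (simp add: field_simps)
  moreover have "(1 / real n) *\<^sub>R (\<Sum>i=1..n. h i w) - (1 / real n) *\<^sub>R (\<Sum>i=1..n. h i z)
      = (1 / real n) *\<^sub>R (\<Sum>i=1..n. h i w - h i z)"
    by (simp add: sum_subtractf scaleR_diff_right)
  ultimately show ?thesis by simp
qed

lemma shuffled_epoch_drift:
  fixes v :: "nat \<Rightarrow> 'a::real_inner" and h :: "nat \<Rightarrow> 'a \<Rightarrow> 'a"
  assumes "n \<ge> 1" and "\<eta> > 0" and "L > 0" and "\<eta> * L \<le> 1 / 2" and "p permutes {1..n}"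
    and step: "\<And>i. i \<in> {1..n} \<Longrightarrow> v i = v (i - 1) - (\<eta> / real n) *\<^sub>R h (p i) (v (i - 1))"
    and lip: "\<And>i w z. i \<in> {1..n} \<Longrightarrow> norm (h i w - h i z) \<le> L * norm (w - z)"
    and H: "\<And>w. H w = (1 / real n) *\<^sub>R (\<Sum>i=1..n. h i w)"
    and var: "(1 / real n) * (\<Sum>i=1..n. (norm (h i (v 0) - H (v 0)))\<^sup>2)
      \<le> \<Theta> * (norm (H (v 0)))\<^sup>2 + \<sigma>\<^sup>2"
  obtains e where "v n = v 0 - \<eta> *\<^sub>R (H (v 0) + e)"
    and "(norm e)\<^sup>2 \<le> 8 * (\<eta> * L)\<^sup>2 * ((1 + \<Theta>) * (norm (H (v 0)))\<^sup>2 + \<sigma>\<^sup>2)"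
proof -
  have pin: "p i \<in> {1..n}" if "i \<in> {1..n}" for i
    using permutes_in_image[OF \<open>p permutes {1..n}\<close>] that by blast
  have reindex: "(\<Sum>i=1..n. u (p i)) = (\<Sum>i=1..n. u i)" for u :: "nat \<Rightarrow> 'b::comm_monoid_add"
    using sum.permute[OF \<open>p permutes {1..n}\<close>, of u] by (simp add: comp_def)
  have unroll: "v i = v 0 - (\<eta> / real n) *\<^sub>R (\<Sum>j=1..i. h (p j) (v (j - 1)))" if "i \<le> n" for i
    using that
  proof (induction i)
    case (Suc i)
    then show ?case
      using step[of "Suc i"] by (simp add: scaleR_add_right)
  qed simp
  define S where "S = (\<Sum>i=1..n. norm (v (i - 1) - v 0)) / real n"
  define B where "B = (\<Sum>i=1..n. norm (h i (v 0))) / real n"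
  \<comment> \<open>Enlarging the partial sum to all \<open>n\<close> terms makes the bound
    independent of \<open>i\<close>, so that averaging it over \<open>i\<close> bounds
    \<open>S\<close> by itself.\<close>
  have norm_step: "norm (v i - v 0) \<le> \<eta> * (B + L * S)" if "i \<le> n" for i
  proof -
    have "norm (v i - v 0) = \<eta> / real n * norm (\<Sum>j=1..i. h (p j) (v (j - 1)))"
      using unroll[OF that] \<open>\<eta> > 0\<close> by simp
    also have "norm (\<Sum>j=1..i. h (p j) (v (j - 1))) \<le> (\<Sum>j=1..i. norm (h (p j) (v (j - 1))))"
      by (rule norm_sum)
    also have "\<dots> \<le> (\<Sum>j=1..n. norm (h (p j) (v (j - 1))))"
      using that by (intro sum_mono2) auto
    also have "\<dots> \<le> (\<Sum>j=1..n. norm (h (p j) (v 0)) + L * norm (v (j - 1) - v 0))"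
    proof (rule sum_mono)
      fix j assume "j \<in> {1..n}"
      then have "norm (h (p j) (v (j - 1)) - h (p j) (v 0)) \<le> L * norm (v (j - 1) - v 0)"
        using lip pin by blast
      then show "norm (h (p j) (v (j - 1)))
          \<le> norm (h (p j) (v 0)) + L * norm (v (j - 1) - v 0)"
        using norm_triangle_sub[of "h (p j) (v (j - 1))" "h (p j) (v 0)"] by linarith
    qed
    also have "\<dots> = real n * (B + L * S)"
      using \<open>n \<ge> 1\<close> reindex[of "\<lambda>i. norm (h i (v 0))"]
      by (simp add: sum.distrib B_def S_def distrib_left flip: sum_distrib_left)
    finally show ?thesis
      using \<open>n \<ge> 1\<close> \<open>\<eta> > 0\<close> by (simp add: divide_right_mono)
  qed
  have "(\<Sum>i=1..n. norm (v (i - 1) - v 0)) \<le> (\<Sum>i=1..n. \<eta> * (B + L * S))"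
    by (intro sum_mono norm_step) auto
  then have "real n * S \<le> real n * (\<eta> * (B + L * S))"
    using \<open>n \<ge> 1\<close> by (simp add: S_def)
  then have "S \<le> \<eta> * (B + L * S)"
    using \<open>n \<ge> 1\<close> by simp
  moreover have "S \<ge> 0"
    by (simp add: S_def sum_nonneg)
  \<comment> \<open>The term \<open>\<eta> * L * S\<close> is at most \<open>S / 2\<close> and moves
    to the left, which doubles the constant.\<close>
  ultimately have S: "S \<le> 2 * \<eta> * B"
    using mult_right_mono[OF \<open>\<eta> * L \<le> 1 / 2\<close>, of S] by (simp add: algebra_simps)
  define e where "e = (1 / real n) *\<^sub>R (\<Sum>i=1..n. h (p i) (v (i - 1)) - h (p i) (v 0))"
  have "v n = v 0 - \<eta> *\<^sub>R (H (v 0) + e)"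
    using unroll[of n] reindex[of "\<lambda>i. h i (v 0)"]
    by (simp add: H e_def sum_subtractf algebra_simps)
  moreover have "(norm e)\<^sup>2 \<le> 8 * (\<eta> * L)\<^sup>2 * ((1 + \<Theta>) * (norm (H (v 0)))\<^sup>2 + \<sigma>\<^sup>2)"
  proof -
    have "norm (\<Sum>i=1..n. h (p i) (v (i - 1)) - h (p i) (v 0))
        \<le> (\<Sum>i=1..n. L * norm (v (i - 1) - v 0))"
      by (intro sum_norm_le lip pin)
    then have "norm e \<le> L * S"
      using \<open>n \<ge> 1\<close> by (simp add: e_def S_def sum_distrib_left divide_right_mono)
    also have "\<dots> \<le> L * (2 * \<eta> * B)"
      using S \<open>L > 0\<close> by simp
    finally have "(norm e)\<^sup>2 \<le> (L * (2 * \<eta> * B))\<^sup>2"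
      by (intro power_mono) auto
    also have "\<dots> = 4 * (\<eta> * L)\<^sup>2 * B\<^sup>2"
      by (simp add: power2_eq_square)
    also have "\<dots> \<le> 4 * (\<eta> * L)\<^sup>2 * (2 * ((1 + \<Theta>) * (norm (H (v 0)))\<^sup>2 + \<sigma>\<^sup>2))"
    \<comment> \<open>Split each gradient into \<open>H (v 0)\<close> and its deviation; the
      variance condition bounds the mean squared deviation. The factor 2 comes from bounding the
      cross term by the squares.\<close>
    proof (intro mult_left_mono)
      show "B\<^sup>2 \<le> 2 * ((1 + \<Theta>) * (norm (H (v 0)))\<^sup>2 + \<sigma>\<^sup>2)"
      proof -
        have "B\<^sup>2 \<le> (\<Sum>i=1..n. (norm (h i (v 0)))\<^sup>2) / real n"
          unfolding B_def by (rule square_mean_le_mean_square) fact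
        also have "\<dots> \<le> (\<Sum>i=1..n. 2 * (norm (H (v 0)))\<^sup>2
            + 2 * (norm (h i (v 0) - H (v 0)))\<^sup>2) / real n"
        proof (intro divide_right_mono sum_mono)
          fix i
          have "norm (h i (v 0)) \<le> norm (H (v 0)) + norm (h i (v 0) - H (v 0))"
            by (rule norm_triangle_sub)
          then have "(norm (h i (v 0)))\<^sup>2 \<le> (norm (H (v 0)) + norm (h i (v 0) - H (v 0)))\<^sup>2"
            by (intro power_mono) auto
          also have "\<dots> \<le> 2 * (norm (H (v 0)))\<^sup>2 + 2 * (norm (h i (v 0) - H (v 0)))\<^sup>2"
            using sum_squares_bound[of "norm (H (v 0))" "norm (h i (v 0) - H (v 0))"]
            by (simp add: power2_sum)
          finally show "(norm (h i (v 0)))\<^sup>2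
              \<le> 2 * (norm (H (v 0)))\<^sup>2 + 2 * (norm (h i (v 0) - H (v 0)))\<^sup>2" .
        qed auto
        also have "\<dots> = 2 * (norm (H (v 0)))\<^sup>2
            + 2 * ((1 / real n) * (\<Sum>i=1..n. (norm (h i (v 0) - H (v 0)))\<^sup>2))"
          using \<open>n \<ge> 1\<close> by (simp add: sum.distrib add_divide_distrib flip: sum_distrib_left)
        finally show ?thesis
          using var by (simp add: algebra_simps)
      qed
    qed simp
    finally show ?thesis
      by (simp add: algebra_simps)
  qed
  ultimately show ?thesis by (rule that)
qed

theorem theorem4p3:
  fixes f :: "nat \<Rightarrow> real ^ 'd \<Rightarrow> real"
    and F :: "real ^ 'd \<Rightarrow> real"
    and xstar :: "real ^ 'd"
    and x y :: "nat \<Rightarrow> real ^ 'd"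
    and v :: "nat \<Rightarrow> nat \<Rightarrow> real ^ 'd"
    and \<pi> :: "nat \<Rightarrow> nat \<Rightarrow> nat"
    and \<eta> :: "nat \<Rightarrow> real"
    and L \<Theta> \<sigma> \<alpha> k :: real
    and n T :: nat
  assumes "L > 0" and "n \<ge> 1"
    and "\<And>i w. i \<in> {1..n} \<Longrightarrow> f i differentiable (at w)"
    and "\<And>i w z. i \<in> {1..n} \<Longrightarrow> norm (grad (f i) w - grad (f i) z) \<le> L * norm (w - z)"
    and "F = avg_fun n f"
    and "convex_on UNIV F"
    and "\<And>w. F xstar \<le> F w"
    and "\<Theta> \<ge> 0" and "\<sigma> \<ge> 0"
    and "\<And>w. (1 / real n) * (\<Sum>i=1..n. (norm (grad (f i) w - grad F w))\<^sup>2)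
              \<le> \<Theta> * (norm (grad F w))\<^sup>2 + \<sigma>\<^sup>2"
    and "T \<ge> 2"
    and "\<alpha> = 1 + 1 / real T"
    and "k = 1 / (exp 1 * \<alpha> * root 3 (2 * (6 * \<Theta> + 7)))"
    and "\<And>t. \<eta> t = k * \<alpha> ^ t / (L * real T)"
    and "y 0 = x 0"
    and "nasg_run n f T (\<lambda>t. (real t - 1) / (real t + 2)) (\<lambda>t i. \<eta> t / real n) \<pi> x y v"
  shows "(\<forall>t\<in>{1..T}. 0 < \<eta> t / real n \<and> \<eta> t \<le> 1 / L) \<and>
         F (x T) - F xstar
           \<le> 8 * \<sigma>\<^sup>2 / (3 * (6 * \<Theta> + 7) * L * real T)
             + 2 * L * exp 1 * root 3 (2 * (6 * \<Theta> + 7)) / real T * (norm (x 0 - xstar))\<^sup>2"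
proof -

  \<comment> \<open>Constants and step-size bounds\<close>
  note L = assms(1) and n = assms(2) and T = assms(11)
  define c where "c = root 3 (2 * (6 * \<Theta> + 7))"
  \<comment> \<open>\<open>K = 1 / c\<^sup>3\<close>, so that \<open>\<eta>\<^sub>t L \<le> 1 / (c (T + 1))\<close> gives \<open>(\<eta>\<^sub>t L)\<^sup>3 \<le> K / (T + 1)\<^sup>3\<close>.\<close>
  define K where "K = 1 / (2 * (6 * \<Theta> + 7))"
  have \<Theta>7: "6 * \<Theta> + 7 > 0" and K: "K > 0"
    using assms(8) by (simp_all add: K_def)
  have c: "c \<ge> 2" and c3: "c ^ 3 = 1 / K"
  proof -
    show "c ^ 3 = 1 / K"
      unfolding c_def K_def using \<Theta>7 by (subst real_root_pow_pos2) auto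
    \<comment> \<open>The radicand is at least 14, hence above 8.\<close>
    have "root 3 8 \<le> c"
      unfolding c_def using assms(8) by (intro real_root_le_mono) auto
    moreover have "root 3 8 = (2::real)"
      by (rule real_root_pos_unique) auto
    ultimately show "c \<ge> 2" by simp
  qed
  have \<alpha>1: "\<alpha> > 1" and \<alpha>T: "\<alpha> * real T = real T + 1"
    using T by (simp_all add: assms(12) distrib_right)
  have k: "k > 0" and kc: "k * (exp 1 * \<alpha> * c) = 1"
    using \<alpha>1 c by (simp_all add: assms(13)[folded c_def])
  have \<alpha>e: "\<alpha> ^ t \<le> exp 1" if "t \<le> T" for t
  proof -
    have "\<alpha> ^ t \<le> \<alpha> ^ T"
      using \<alpha>1 that by (intro power_increasing) auto
    also have "\<dots> \<le> exp (1 / real T) ^ T"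
      using \<alpha>1 exp_ge_add_one_self[of "1 / real T"] assms(12) by (intro power_mono) auto
    also have "\<dots> = exp 1"
      using T by (simp flip: exp_of_nat_mult)
    finally show ?thesis .
  qed
  have \<eta>: "\<eta> t > 0" for t
    using k \<alpha>1 L T assms(14) by simp
  \<comment> \<open>The definition of \<open>k\<close> gives
    \<open>k * exp 1 = 1 / (\<alpha> * c)\<close>, and
    \<open>\<alpha> * real T = real T + 1\<close>.\<close>
  have \<eta>L: "\<eta> t * L \<le> 1 / (c * (real T + 1))" if "t \<le> T" for t
  proof -
    have "\<eta> t * L = k * \<alpha> ^ t / real T"
      using L assms(14) by simp
    also have "\<dots> \<le> k * exp 1 / real T"
      using k \<alpha>e[OF that] by (intro divide_right_mono mult_left_mono) auto
    also have "\<dots> = 1 / (c * (real T + 1))"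
      using kc T c \<alpha>1 unfolding \<alpha>T[symmetric] by (simp add: field_simps)
    finally show ?thesis .
  qed
  have \<eta>L_half: "\<eta> t * L \<le> 1 / 2" if "t \<le> T" for t
  proof -
    have "2 * 1 \<le> c * (real T + 1)"
      using c by (intro mult_mono) auto
    then have "1 / (c * (real T + 1)) \<le> 1 / 2"
      by (intro divide_left_mono) auto
    then show ?thesis
      using \<eta>L[OF that] by linarith
  qed
  have \<eta>L3: "(\<eta> t * L) ^ 3 \<le> K / (real T + 1) ^ 3" if "t \<le> T" for t
  proof -
    have "(\<eta> t * L) ^ 3 \<le> (1 / (c * (real T + 1))) ^ 3"
      using \<eta>L[OF that] \<eta>[of t] L by (intro power_mono) auto
    also have "\<dots> = K / (real T + 1) ^ 3"
      by (simp add: power_divide power_mult_distrib c3)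
    finally show ?thesis .
  qed

  \<comment> \<open>The gradient of the average\<close>
  define H where "H w = (1 / real n) *\<^sub>R (\<Sum>i=1..n. grad (f i) w)" for w
  have gderiv: "GDERIV F w :> H w" for w
    unfolding assms(5) H_def by (intro gderiv_avg_fun assms(3))
  have gradF: "grad F w = H w" for w
    by (rule grad_eqI[OF gderiv])
  have lip: "norm (H w - H z) \<le> L * norm (w - z)" for w z
    unfolding H_def using n assms(4) by (intro lipschitz_average) auto

  \<comment> \<open>The potential and the extrapolated sequence\<close>
  define a where "a = k * \<alpha> / (L * real T)"
  have a: "a > 0"
    using k \<alpha>1 L T by (simp add: a_def)
  \<comment> \<open>Truncated subtraction makes \<open>z 0 = x 0\<close>.\<close>
  define z where "z t = x (t - 1) + ((real t + 1) / 2) *\<^sub>R (x t - x (t - 1))" for t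
  \<comment> \<open>The weight \<open>t (t + 2) / 4\<close> is the coefficient
    \<open>(1 - \<theta>) / \<theta>\<^sup>2\<close> of the old value in the next epoch. Since
    \<open>\<eta> t = a * \<alpha> ^ (t - 1)\<close> for positive \<open>t\<close>, the geometric
    growth of the step sizes is moved into the distance term.\<close>
  define P where "P t = a * (real t * (real t + 2) / 4) * (F (x t) - F xstar)
    + (norm (z t - xstar))\<^sup>2 / (2 * \<alpha> ^ t)" for t

  have run: "v t 0 = y (t - 1)" "\<pi> t permutes {1..n}" "x t = v t n"
      "\<And>i. i \<in> {1..n} \<Longrightarrow>
        v t i = v t (i - 1) - (\<eta> t / real n) *\<^sub>R grad (f (\<pi> t i)) (v t (i - 1))"
      "y t = x t + ((real t - 1) / (real t + 2)) *\<^sub>R (x t - x (t - 1))"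
    if "t \<in> {1..T}" for t
    using assms(16) that unfolding nasg_run_def by blast+

  \<comment> \<open>The momentum \<open>(t - 1) / (t + 2)\<close> is exactly what makes
    \<open>y t\<close> this combination, with weight \<theta> of epoch \<open>t + 1\<close>. Index 0
    is separate because there \<open>y 0 = x 0\<close> is an initial condition.\<close>
  have y_eq: "y t = (1 - 2 / (real t + 2)) *\<^sub>R x t + (2 / (real t + 2)) *\<^sub>R z t" if "t \<le> T" for t
  proof (cases "t = 0")
    case True
    then show ?thesis by (simp add: assms(15) z_def)
  next
    case False
    have eq1: "1 - 2 / (real t + 2) = real t / (real t + 2)"
      by (simp add: field_simps)
    have nz: "real t + 2 \<noteq> 0"
      by simp
    have "(real t + 2) *\<^sub>R y t = (real t + 2) *\<^sub>R x t + (real t - 1) *\<^sub>R (x t - x (t - 1))"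
      using run(5)[of t] that False by (simp add: scaleR_add_right)
    also have "\<dots> = real t *\<^sub>R x t + 2 *\<^sub>R x (t - 1) + (real t + 1) *\<^sub>R (x t - x (t - 1))"
      by (simp add: algebra_simps scaleR_2)
    also have "\<dots> = real t *\<^sub>R x t + 2 *\<^sub>R z t"
      by (simp add: z_def scaleR_add_right)
    also have "\<dots> = (real t + 2) *\<^sub>R
        ((real t / (real t + 2)) *\<^sub>R x t + (2 / (real t + 2)) *\<^sub>R z t)"
      by (simp only: scaleR_add_right scaleR_scaleR times_divide_eq_right
          nonzero_mult_div_cancel_left[OF nz])
    finally show ?thesis
      using nz unfolding eq1 by (simp only: scaleR_cancel_left simp_thms)
  qed

  \<comment> \<open>Growth of the potential over one epoch\<close>
  have P_step: "P (Suc m) \<le> P m + a * K * \<sigma>\<^sup>2 / L" if "m < T" for m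
  proof -
    define t where "t = Suc m"
    define \<theta> where "\<theta> = 2 / (real t + 1)"
    have t: "t \<in> {1..T}" "t \<le> T"
      using that by (auto simp: t_def)
    have v0: "v t 0 = y m"
      using run(1)[OF t(1)] by (simp add: t_def)
    obtain e where step: "v t n = v t 0 - \<eta> t *\<^sub>R (H (v t 0) + e)"
      and e: "(norm e)\<^sup>2 \<le> 8 * (\<eta> t * L)\<^sup>2 * ((1 + \<Theta>) * (norm (H (v t 0)))\<^sup>2 + \<sigma>\<^sup>2)"
    proof (rule shuffled_epoch_drift[OF n \<eta> L \<eta>L_half[OF t(2)] run(2)[OF t(1)]
          run(4)[OF t(1)] assms(4) H_def])
      show "1 / real n * (\<Sum>i=1..n. (norm (grad (f i) (v t 0) - H (v t 0)))\<^sup>2)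
          \<le> \<Theta> * (norm (H (v t 0)))\<^sup>2 + \<sigma>\<^sup>2"
        using assms(10)[of "v t 0"] by (simp add: gradF)
    qed
    define g where "g = H (y m)"
    have \<theta>: "0 < \<theta>" "\<theta> \<le> 1"
      by (simp_all add: \<theta>_def t_def)
    have zt: "z t = x m + (1 / \<theta>) *\<^sub>R (x t - x m)"
      by (simp add: z_def \<theta>_def t_def)
    have "\<eta> t / \<theta>\<^sup>2 * (F (x t) - F xstar) + (norm (z t - xstar))\<^sup>2 / 2
      \<le> \<eta> t * (1 - \<theta>) / \<theta>\<^sup>2 * (F (x m) - F xstar) + (norm (z m - xstar))\<^sup>2 / 2
        - \<eta> t / (2 * L * \<theta>) * (norm g)\<^sup>2 - \<eta> t / \<theta> * (e \<bullet> (z t - xstar))"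
    proof (rule accelerated_step_inexact_gradient[where y = "y m"])
      show "\<eta> t * L \<le> 1"
        using \<eta>L_half[OF t(2)] by simp
      show "x t = y m - \<eta> t *\<^sub>R (g + e)"
        using step run(3)[OF t(1)] by (simp add: v0 g_def)
      show "y m = (1 - \<theta>) *\<^sub>R x m + \<theta> *\<^sub>R z m"
        using y_eq[of m] that by (simp add: \<theta>_def t_def add.commute)
      show "F (x t) \<le> F (y m) + g \<bullet> (x t - y m) + L / 2 * (norm (x t - y m))\<^sup>2"
        unfolding g_def by (rule lipschitz_gderiv_upper_bound[OF gderiv lip])
      show "F (x m) \<ge> F (y m) + g \<bullet> (x m - y m)"
        unfolding g_def by (rule convex_on_above_gderiv_tangent[OF assms(6) gderiv])
      show "F xstar \<ge> F (y m) + g \<bullet> (xstar - y m) + (norm g)\<^sup>2 / (2 * L)"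
        unfolding g_def
        by (rule convex_on_above_tangent_at_minimum[OF gderiv lip assms(6,7) L])
    qed (fact \<theta> \<eta> L zt)+
    \<comment> \<open>The weight \<open>real T + 1\<close> is chosen so that the remaining distance
      coefficient is \<open>1 - 1 / (real T + 1) = 1 / \<alpha>\<close>.\<close>
    moreover have "- (\<eta> t / \<theta> * (e \<bullet> (z t - xstar)))
        \<le> (norm (z t - xstar))\<^sup>2 / (2 * (real T + 1))
          + (real T + 1) / 2 * (\<eta> t / \<theta>)\<^sup>2 * (norm e)\<^sup>2"
      by (rule neg_inner_le_weighted_norms) simp
    moreover have "(real T + 1) / 2 * (\<eta> t / \<theta>)\<^sup>2 * (norm e)\<^sup>2
        \<le> \<eta> t / (2 * L * \<theta>) * (norm g)\<^sup>2 + \<eta> t * K * \<sigma>\<^sup>2 / L"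
    proof -
      define r s where "r = real T + 1" and "s = real t + 1"
      have rs: "r \<ge> 1" "s \<ge> 0" "s \<le> r" "\<theta> = 2 / s"
        using t by (auto simp: r_def s_def \<theta>_def)
      define W where "W = (1 + \<Theta>) * (norm g)\<^sup>2 + \<sigma>\<^sup>2"
      have W: "W \<ge> 0"
        using assms(8) by (simp add: W_def)
      have "r / 2 * (\<eta> t / \<theta>)\<^sup>2 * (norm e)\<^sup>2 \<le> r / 2 * (\<eta> t / \<theta>)\<^sup>2 * (8 * (\<eta> t * L)\<^sup>2 * W)"
        using e rs by (intro mult_left_mono) (auto simp: v0 g_def W_def)
      \<comment> \<open>Isolates one factor \<open>(\<eta> t * L) ^ 3\<close>, whose bound
        \<open>K / r ^ 3\<close> leaves only the ratio \<open>s / r\<close>.\<close>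
      also have "\<dots> = r * s\<^sup>2 * (\<eta> t / L) * W * (\<eta> t * L) ^ 3"
        using L by (simp add: rs power2_eq_square power3_eq_cube field_simps)
      also have "\<dots> \<le> r * s\<^sup>2 * (\<eta> t / L) * W * (K / r ^ 3)"
        using \<eta>L3[OF t(2)] rs W \<eta>[of t] L
        by (intro mult_left_mono) (auto simp: r_def)
      also have "\<dots> = \<eta> t / L * K * W * (s / r)\<^sup>2"
        using rs by (simp add: power2_eq_square power3_eq_cube field_simps)
      also have "\<dots> = \<eta> t / L * (K * (1 + \<Theta>)) * (norm g)\<^sup>2 * (s / r)\<^sup>2
          + \<eta> t / L * K * \<sigma>\<^sup>2 * (s / r)\<^sup>2"
        by (simp add: W_def algebra_simps)
      \<comment> \<open>The target is the available gradient term: with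
        \<open>\<theta> = 2 / s\<close>, \<open>\<eta> t / (2 * L * \<theta>)\<close> equals
        \<open>\<eta> t / L * (1 / 4) * s\<close>.\<close>
      also have "\<eta> t / L * (K * (1 + \<Theta>)) * (norm g)\<^sup>2 * (s / r)\<^sup>2
          \<le> \<eta> t / L * (1 / 4) * (norm g)\<^sup>2 * s"
      proof (intro mult_mono)
        show "K * (1 + \<Theta>) \<le> 1 / 4"
          using assms(8) by (simp add: K_def field_simps)
        have "s * s \<le> s * (r * r)"
          using rs mult_mono[of 1 r s r] by (intro mult_left_mono) auto
        then show "(s / r)\<^sup>2 \<le> s"
          using rs by (simp add: power2_eq_square field_simps)
      qed (use \<eta>[of t] L K rs assms(8) in auto)
      also have "\<eta> t / L * K * \<sigma>\<^sup>2 * (s / r)\<^sup>2 \<le> \<eta> t / L * K * \<sigma>\<^sup>2 * 1"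
        using rs \<eta>[of t] L K by (intro mult_left_mono power_le_one) auto
      finally show ?thesis
        using rs by (simp add: r_def)
    qed
    moreover have "(1 - 1 / (real T + 1)) * ((norm (z t - xstar))\<^sup>2 / 2)
        = (norm (z t - xstar))\<^sup>2 / 2 - (norm (z t - xstar))\<^sup>2 / (2 * (real T + 1))"
      by (simp only: left_diff_distrib times_divide_times_eq mult_1_left mult.commute)
    ultimately have ineq: "\<eta> t / \<theta>\<^sup>2 * (F (x t) - F xstar)
        + (1 - 1 / (real T + 1)) * ((norm (z t - xstar))\<^sup>2 / 2)
      \<le> \<eta> t * (1 - \<theta>) / \<theta>\<^sup>2 * (F (x m) - F xstar) + (norm (z m - xstar))\<^sup>2 / 2
        + \<eta> t * K * \<sigma>\<^sup>2 / L"
      by linarith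
    have \<alpha>_inv: "1 - 1 / (real T + 1) = 1 / \<alpha>"
      using T by (simp add: assms(12) field_simps)
    have coeffs: "\<eta> t / \<theta>\<^sup>2 = \<eta> t * ((real t + 1)\<^sup>2 / 4)"
        "\<eta> t * (1 - \<theta>) / \<theta>\<^sup>2 = \<eta> t * (real m * (real m + 2) / 4)"
      by (simp_all add: \<theta>_def t_def power2_eq_square field_simps)
    \<comment> \<open>Lowering \<open>(t + 1)\<^sup>2\<close> to \<open>t (t + 2)\<close> is safe
      because \<open>F (x t)\<close> is at least the minimum; it makes the new coefficient match the
      one used in the next epoch.\<close>
    have "\<eta> t * (real t * (real t + 2) / 4) * (F (x t) - F xstar)
        \<le> \<eta> t * ((real t + 1)\<^sup>2 / 4) * (F (x t) - F xstar)"
      using \<eta>[of t] assms(7)[of "x t"]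
      by (intro mult_right_mono mult_left_mono) (auto simp: power2_eq_square field_simps)
    moreover have "1 / \<alpha> * ((norm (z t - xstar))\<^sup>2 / 2) = (norm (z t - xstar))\<^sup>2 / (2 * \<alpha>)"
      by simp
    ultimately have "\<eta> t * (real t * (real t + 2) / 4) * (F (x t) - F xstar)
        + (norm (z t - xstar))\<^sup>2 / (2 * \<alpha>)
      \<le> \<eta> t * (real m * (real m + 2) / 4) * (F (x m) - F xstar) + (norm (z m - xstar))\<^sup>2 / 2
        + \<eta> t * K * \<sigma>\<^sup>2 / L"
      using ineq unfolding coeffs \<alpha>_inv by linarith
    moreover have "\<eta> t = a * \<alpha> ^ m"
      by (simp add: assms(14) a_def t_def)
    \<comment> \<open>Every term now matches the potential inequality multiplied by
      \<open>\<alpha> ^ m\<close>, which is cancelled at the end.\<close>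
    ultimately have "(a * (real t * (real t + 2) / 4) * (F (x t) - F xstar)) * \<alpha> ^ m
        + (norm (z t - xstar))\<^sup>2 / (2 * \<alpha>)
      \<le> (a * (real m * (real m + 2) / 4) * (F (x m) - F xstar)) * \<alpha> ^ m
        + (norm (z m - xstar))\<^sup>2 / 2 + (a * K * \<sigma>\<^sup>2 / L) * \<alpha> ^ m"
      by (simp add: mult_ac)
    moreover have "P t * \<alpha> ^ m = (a * (real t * (real t + 2) / 4) * (F (x t) - F xstar)) * \<alpha> ^ m
        + (norm (z t - xstar))\<^sup>2 / (2 * \<alpha>)"
      unfolding P_def distrib_right using \<alpha>1 by (simp add: t_def)
    moreover have "P m * \<alpha> ^ m = (a * (real m * (real m + 2) / 4) * (F (x m) - F xstar)) * \<alpha> ^ m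
        + (norm (z m - xstar))\<^sup>2 / 2"
      unfolding P_def distrib_right using \<alpha>1 by simp
    ultimately have "P t * \<alpha> ^ m \<le> (P m + a * K * \<sigma>\<^sup>2 / L) * \<alpha> ^ m"
      by (simp add: distrib_right)
    then show ?thesis
      using \<alpha>1 by (simp add: t_def)
  qed

  \<comment> \<open>Summation over the epochs and the final constants\<close>
  have "P m \<le> P 0 + real m * (a * K * \<sigma>\<^sup>2 / L)" if "m \<le> T" for m
    using that
  proof (induction m)
    case (Suc m)
    then show ?case
      using P_step[of m] by (simp add: distrib_right add_divide_distrib)
  qed simp
  \<comment> \<open>At index 0 the function-value term has weight zero, so only the initial distance
    remains.\<close>
  from this[of T] have PT: "P T \<le> (norm (x 0 - xstar))\<^sup>2 / 2 + real T * (a * K * \<sigma>\<^sup>2 / L)"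
    by (simp add: P_def z_def)
  define \<tau> where "\<tau> = real T"
  have \<tau>: "\<tau> > 0"
    using T by (simp add: \<tau>_def)
  have "(a * \<tau> / 4) * ((\<tau> + 2) * (F (x T) - F xstar)) \<le> P T"
    using \<alpha>1 by (simp add: P_def \<tau>_def)
  also have "\<dots> \<le> (a * \<tau> / 4) * (2 / (a * \<tau>) * (norm (x 0 - xstar))\<^sup>2 + 4 * K * \<sigma>\<^sup>2 / L)"
    using PT a \<tau> by (simp add: distrib_left mult_ac flip: \<tau>_def)
  finally have "(\<tau> + 2) * (F (x T) - F xstar)
      \<le> 2 / (a * \<tau>) * (norm (x 0 - xstar))\<^sup>2 + 4 * K * \<sigma>\<^sup>2 / L"
    using a \<tau> by simp
  moreover have "\<tau> * (F (x T) - F xstar) \<le> (\<tau> + 2) * (F (x T) - F xstar)"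
    using assms(7)[of "x T"] by (intro mult_right_mono) auto
  \<comment> \<open>Here \<open>a * \<tau> = k * \<alpha> / L\<close>, and \<open>kc\<close> inverts
    \<open>k * \<alpha>\<close>.\<close>
  moreover have "2 / (a * \<tau>) = 2 * L * exp 1 * c"
    using kc k \<alpha>1 L \<tau> unfolding a_def \<tau>_def[symmetric] by (simp add: field_simps)
  \<comment> \<open>The argument yields the noise constant \<open>6 / 3\<close>, which is rounded up
    to \<open>8 / 3\<close>.\<close>
  moreover have "4 * K * \<sigma>\<^sup>2 / L \<le> 8 * \<sigma>\<^sup>2 / (3 * (6 * \<Theta> + 7) * L)"
  proof -
    define D where "D = 6 * \<Theta> + 7"
    have "4 * K * \<sigma>\<^sup>2 / L = 6 * \<sigma>\<^sup>2 / (3 * D * L)"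
      by (simp add: K_def flip: D_def)
    also have "\<dots> \<le> 8 * \<sigma>\<^sup>2 / (3 * D * L)"
      using L \<Theta>7 by (intro divide_right_mono) (auto simp: D_def)
    finally show ?thesis
      by (simp only: D_def)
  qed
  ultimately have "\<tau> * (F (x T) - F xstar)
      \<le> 8 * \<sigma>\<^sup>2 / (3 * (6 * \<Theta> + 7) * L) + 2 * L * exp 1 * c * (norm (x 0 - xstar))\<^sup>2"
    by (simp only:)
  from divide_right_mono[OF this, of \<tau>]
  have "F (x T) - F xstar \<le> 8 * \<sigma>\<^sup>2 / (3 * (6 * \<Theta> + 7) * L * real T)
      + 2 * L * exp 1 * root 3 (2 * (6 * \<Theta> + 7)) / real T * (norm (x 0 - xstar))\<^sup>2"
    unfolding c_def[symmetric] \<tau>_def[symmetric] using \<tau> by (simp add: add_divide_distrib)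
  moreover have "\<eta> t \<le> 1 / L" if "t \<le> T" for t
    using \<eta>L_half[OF that] L by (simp add: field_simps)
  ultimately show ?thesis
    using \<eta> n by simp
qed

end
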